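(* Let $N,S$ be positive integers, and let $Q$ denote the I/O complexity (minimum number of Load moves over all complete red-white pebble games with $S$ red pebbles) of the CDAG of the Hessenberg reduction program below applied to an $N\times N$ matrix $A$. Then $$\frac{1}{12}\cdot\frac{N^4}{N+2S} \leq Q .$$
   Context: Program (Hessenberg reduction, corresponding to LAPACK GEHD2), with $n=N$, input $N\times N$ array $A$, array $tmp$ of length $N$, scalars $norma2$, $norma$, $tau$: for j = 0,...,n-3: norma2 = 0.0 for i = j+2,...,n-1: norma2 += A[i][j]*A[i][j] norma = sqrt(A[j+1][j]*A[j+1][j] + norma2) A[j+1][j] = (A[j+1][j] > 0) ? (A[j+1][j] + norma) : (A[j+1][j] - norma) tau = 2.0 / (1.0 + norma2 / (A[j+1][j]*A[j+1][j])) for i = j+2,...,n-1: A[i][j] /= A[j+1][j] A[j+1][j] = (A[j+1][j] > 0) ? (-norma) : (norma) for i = j+1,...,n-1: tmp[i] = A[j+1][i] for k = j+2,...,n-1: tmp[i] += A[k][j]*A[k][i] for i = j+1,...,n-1: tmp[i] *= tau for i = j+1,...,n-1: A[j+1][i] -= tmp[i] for i = j+2,...,n-1: for k = j+1,...,n-1: A[i][k] -= A[i][j]*tmp[k] for i = 0,...,n-1: tmp[i] = A[i][j+1] for k = j+2,...,n-1: tmp[i] += A[i][k]*A[k][j] for i = 0,...,n-1: tmp[i] *= tau for i = 0,...,n-1: A[i][j+1] -= tmp[i] for i = 0,...,n-1: for k = j+2,...,n-1: A[i][k] -= tmp[i]*A[k][j] CDAG of a program: a directed acyclic graph whose nodes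 are the input values (initial values of array entries read before being written) and the statement instances (each execution of an assignment statement, including compound assignments), with an edge $u\to v$ whenever the instance $v$ reads a value produced by $u$ (flow dependence). Input nodes have no incoming edges. Red-white pebble game with $S$ red pebbles on a CDAG: initially only the input nodes carry white pebbles and there are no red pebbles. Allowed moves: (Spill) remove a red pebble from a node; (Compute) if a node has no white pebble and all its predecessors carry red pebbles, place a white and a red pebble on it; (Load) place a red pebble on a node carrying a white pebble. At no time may more than $S$ red pebbles be on the graph. The game is complete when every node carries a white pebble. The I/O complexity $Q$ is the minimum, over all complete games, of the number of Load moves.
   Formalization: The formal theorem assumes N ≥ 3: for N = 1 or 2 the program executes no statement, so its CDAG is empty and Q = 0, while the left-hand side is positive, and the stated bound fails. *)

theory Defs
  imports "HOL-Library.Extended_Real"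
begin

section \<open>Red-white pebble game on a computational DAG\<close>

record 'v cdag =
  nodes :: "'v set"
  inputs :: "'v set"
  edges :: "('v \<times> 'v) set"

definition preds :: "'v cdag \<Rightarrow> 'v \<Rightarrow> 'v set" where
  "preds G v = {u. (u, v) \<in> edges G}"

datatype 'v move = Spill 'v | Compute 'v | Load 'v

text \<open>A configuration is the pair of the sets of red-pebbled and white-pebbled nodes.\<close>

type_synonym 'v config = "'v set \<times> 'v set"

fun apply_move :: "'v config \<Rightarrow> 'v move \<Rightarrow> 'v config" where
  "apply_move (R, W) (Spill v) = (R - {v}, W)"
| "apply_move (R, W) (Compute v) = (insert v R, insert v W)"
| "apply_move (R, W) (Load v) = (insert v R, W)"

fun enabled :: "'v cdag \<Rightarrow> 'v config \<Rightarrow> 'v move \<Rightarrow> bool" where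
  "enabled G (R, W) (Spill v) \<longleftrightarrow> v \<in> R"
| "enabled G (R, W) (Compute v) \<longleftrightarrow> v \<in> nodes G \<and> v \<notin> W \<and> preds G v \<subseteq> R"
| "enabled G (R, W) (Load v) \<longleftrightarrow> v \<in> W"

fun legal :: "'v cdag \<Rightarrow> nat \<Rightarrow> 'v config \<Rightarrow> 'v move list \<Rightarrow> bool" where
  "legal G S c [] \<longleftrightarrow> True"
| "legal G S c (m # ms) \<longleftrightarrow>
     enabled G c m \<and> card (fst (apply_move c m)) \<le> S \<and> legal G S (apply_move c m) ms"

definition initial :: "'v cdag \<Rightarrow> 'v config" where
  "initial G = ({}, inputs G)"

definition complete_game :: "'v cdag \<Rightarrow> nat \<Rightarrow> 'v move list \<Rightarrow> bool" where
  "complete_game G S ms \<longleftrightarrow>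
     legal G S (initial G) ms \<and> nodes G \<subseteq> snd (foldl apply_move (initial G) ms)"

definition loads :: "'v move list \<Rightarrow> nat" where
  "loads ms = length (filter (\<lambda>m. \<exists>v. m = Load v) ms)"

text \<open>The infimum in \<^typ>\<open>enat\<close> is a minimum if a complete game exists; it is \<open>\<infinity>\<close> if there
  are too few red pebbles for any complete game.\<close>

definition io_complexity :: "'v cdag \<Rightarrow> nat \<Rightarrow> enat" where
  "io_complexity G S = (INF ms \<in> {ms. complete_game G S ms}. enat (loads ms))"


section \<open>CDAG of a straight-line execution trace\<close>

text \<open>An instance \<open>Stmt s is x X\<close> is the execution of the assignment statement number \<open>s\<close> of
  the program at iteration vector \<open>is\<close>; it reads the memory locations \<open>X\<close> and then writes \<open>x\<close>.
  The pair \<open>(s, is)\<close> only serves to tell different executions apart.\<close>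

datatype 'l inst = Stmt (stmt: nat) (iter: "nat list") (lhs: 'l) (rhs: "'l set")

datatype 'l node = Input 'l | Inst "'l inst"

text \<open>Location \<open>x\<close> is read by instance \<open>v\<close> before any instance writes it.\<close>

definition reads_input :: "'l inst list \<Rightarrow> 'l \<Rightarrow> 'l inst \<Rightarrow> bool" where
  "reads_input tr x v \<longleftrightarrow>
     (\<exists>xs ys. tr = xs @ v # ys \<and> x \<in> rhs v \<and> (\<forall>w \<in> set xs. lhs w \<noteq> x))"

text \<open>Flow dependence: \<open>u\<close> is the last write, before \<open>v\<close>, to a location that \<open>v\<close> reads.\<close>

definition flow_dep :: "'l inst list \<Rightarrow> 'l inst \<Rightarrow> 'l inst \<Rightarrow> bool" where
  "flow_dep tr u v \<longleftrightarrow>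
     (\<exists>xs ys zs. tr = xs @ u # ys @ v # zs \<and> lhs u \<in> rhs v \<and> (\<forall>w \<in> set ys. lhs w \<noteq> lhs u))"

definition cdag_of :: "'l inst list \<Rightarrow> 'l node cdag" where
  "cdag_of tr =
    \<lparr> nodes = {Input x |x. \<exists>v. reads_input tr x v} \<union> Inst ` set tr,
      inputs = {Input x |x. \<exists>v. reads_input tr x v},
      edges = {(Input x, Inst v) |x v. reads_input tr x v}
            \<union> {(Inst u, Inst v) |u v. flow_dep tr u v} \<rparr>"


section \<open>Hessenberg reduction (GEHD2)\<close>

datatype loc = A nat nat | Tmp nat | Norma2 | Norma | Tau

definition hess_step :: "nat \<Rightarrow> nat \<Rightarrow> loc inst list" where
  "hess_step n j =
     [Stmt 0 [j] Norma2 {}]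
   @ [Stmt 1 [j, i] Norma2 {Norma2, A i j}. i \<leftarrow> [j+2..<n]]
   @ [Stmt 2 [j] Norma {A (j+1) j, Norma2},
      Stmt 3 [j] (A (j+1) j) {A (j+1) j, Norma},
      Stmt 4 [j] Tau {Norma2, A (j+1) j}]
   @ [Stmt 5 [j, i] (A i j) {A i j, A (j+1) j}. i \<leftarrow> [j+2..<n]]
   @ [Stmt 6 [j] (A (j+1) j) {A (j+1) j, Norma}]
   @ concat [Stmt 7 [j, i] (Tmp i) {A (j+1) i}
             # [Stmt 8 [j, i, k] (Tmp i) {Tmp i, A k j, A k i}. k \<leftarrow> [j+2..<n]].
             i \<leftarrow> [j+1..<n]]
   @ [Stmt 9 [j, i] (Tmp i) {Tmp i, Tau}. i \<leftarrow> [j+1..<n]]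
   @ [Stmt 10 [j, i] (A (j+1) i) {A (j+1) i, Tmp i}. i \<leftarrow> [j+1..<n]]
   @ [Stmt 11 [j, i, k] (A i k) {A i k, A i j, Tmp k}. i \<leftarrow> [j+2..<n], k \<leftarrow> [j+1..<n]]
   @ concat [Stmt 12 [j, i] (Tmp i) {A i (j+1)}
             # [Stmt 13 [j, i, k] (Tmp i) {Tmp i, A i k, A k j}. k \<leftarrow> [j+2..<n]].
             i \<leftarrow> [0..<n]]
   @ [Stmt 14 [j, i] (Tmp i) {Tmp i, Tau}. i \<leftarrow> [0..<n]]
   @ [Stmt 15 [j, i] (A i (j+1)) {A i (j+1), Tmp i}. i \<leftarrow> [0..<n]]
   @ [Stmt 16 [j, i, k] (A i k) {A i k, Tmp i, A k j}. i \<leftarrow> [0..<n], k \<leftarrow> [j+2..<n]]"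

definition hessenberg :: "nat \<Rightarrow> loc inst list" where
  "hessenberg n = concat [hess_step n j. j \<leftarrow> [0..<n-2]]"

definition hessenberg_Q :: "nat \<Rightarrow> nat \<Rightarrow> enat" where
  "hessenberg_Q N S = io_complexity (cdag_of (hessenberg N)) S"

lemma distinct_concat_map:
  assumes "distinct xs" "\<And>x. x \<in> set xs \<Longrightarrow> distinct (f x)"
    and "\<And>x y v. x \<in> set xs \<Longrightarrow> y \<in> set xs \<Longrightarrow> v \<in> set (f x) \<Longrightarrow> v \<in> set (f y) \<Longrightarrow> x = y"
  shows "distinct (concat (map f xs))"
  using assms
proof (induction xs)
  case (Cons a xs)
  have "distinct (concat (map f xs))"
    using Cons.prems by (intro Cons.IH) auto
  moreover have "set (f a) \<inter> set (concat (map f xs)) = {}"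
    using Cons.prems(1,3) by fastforce
  ultimately show ?case
    using Cons.prems(2) by simp
qed simp

lemma distinct_hess_step: "distinct (hess_step n j)"
proof -
  have app: "distinct (xs @ ys)"
    if "distinct xs" "distinct ys" "\<forall>u \<in> set xs. stmt u < m" "\<forall>v \<in> set ys. m \<le> stmt v"
    for xs ys :: "loc inst list" and m
    using that by fastforce
  show ?thesis
    unfolding hess_step_def
    apply (rule app[where m = 1], simp)
     apply (rule app[where m = 2], simp add: distinct_map inj_on_def)
       apply (rule app[where m = 5], simp)
        apply (rule app[where m = 6], simp add: distinct_map inj_on_def)
          apply (rule app[where m = 7], simp)
           apply (rule app[where m = 9])
              apply (rule distinct_concat_map; force simp: distinct_map inj_on_def)
             apply (rule app[where m = 10], simp add: distinct_map inj_on_def)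
               apply (rule app[where m = 11], simp add: distinct_map inj_on_def)
                 apply (rule app[where m = 12])
                    apply (rule distinct_concat_map; force simp: distinct_map inj_on_def)
                   apply (rule app[where m = 14])
                      apply (rule distinct_concat_map; force simp: distinct_map inj_on_def)
                     apply (rule app[where m = 15], simp add: distinct_map inj_on_def)
                       apply (rule app[where m = 16], simp add: distinct_map inj_on_def)
                         apply (rule distinct_concat_map; force simp: distinct_map inj_on_def)
    by (auto simp: ball_Un)
qed

text \<open>Different positions of the trace are different instances.\<close>

lemma distinct_hessenberg: "distinct (hessenberg n)"
proof -
  have "hd (iter v) = j" if "v \<in> set (hess_step n j)" for v j
    using that by (auto simp: hess_step_def)
  then show ?thesis
    unfolding hessenberg_def by (intro distinct_concat_map distinct_hess_step) auto
qed

text \<open>For \<open>N \<le> 2\<close> the program executes no statement, so that no load is needed.\<close>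

lemma hessenberg_Q_trivial:
  assumes "N \<le> 2"
  shows "hessenberg_Q N S = 0"
proof -
  have "hessenberg N = []"
    using assms by (simp add: hessenberg_def)
  then have "complete_game (cdag_of (hessenberg N)) S []"
    by (simp add: complete_game_def cdag_of_def reads_input_def)
  then have "hessenberg_Q N S \<le> enat (loads ([] :: loc node move list))"
    unfolding hessenberg_Q_def io_complexity_def by (intro INF_lower) simp
  then show ?thesis by (simp add: loads_def zero_enat_def[symmetric])
qed

end

theory Submission
  imports Defs "HOL-Library.Product_Lexorder"
begin

text \<open>
  Cut a game into segments of \<open>T\<close> loads. The set \<open>E\<close> of nodes computed in a segment is convex, and
  at most \<open>K = S + T\<close> nodes outside \<open>E\<close> are operands of nodes in \<open>E\<close>. Count the updates
  \<open>A[i][k] -= tmp[i] * A[k][j]\<close> of the first \<open>L\<close> iterations in \<open>E\<close>, with \<open>w = n - L + 1\<close>. If a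
  row \<open>i\<close> has updates in \<open>E\<close> at iterations \<open>a < b\<close>, then it has all its updates of the iterations
  strictly between: the updates of a row in one iteration depend on a single value \<open>tmp[i]\<close>, which
  depends on all of the row. Hence, apart from at most three iterations for each cell of \<open>A\<close>, the
  updates in \<open>E\<close> lie in rows with at least \<open>w\<close> updated cells each and use entries of Householder
  vectors. These entries are not in \<open>E\<close>, for otherwise \<open>E\<close> would contain almost an entire iteration.
  So with \<open>c\<close> updated cells and \<open>v\<close> vector entries, \<open>c + v \<le> K\<close> and there are at most
  \<open>3 c + (c / w) v \<le> (K + 3 w)\<^sup>2 / (4 w)\<close> updates in \<open>E\<close>. Now take \<open>L = n div 2\<close> and \<open>T = S + 3 w\<close>.
  If \<open>S\<close> is so large that the argument does not apply, then loading the \<open>n\<^sup>2 - 1\<close> inputs suffices.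
\<close>

section \<open>Segments of a pebble game\<close>

text \<open>The invariant of the white nodes. The difference of two such sets is convex with respect
  to paths.\<close>

definition down_closed :: "'v cdag \<Rightarrow> 'v set \<Rightarrow> bool" where
  "down_closed G W \<longleftrightarrow> inputs G \<subseteq> W \<and> (\<forall>u v. (u, v) \<in> edges G \<longrightarrow> v \<in> W \<longrightarrow> u \<in> W)"

lemma down_closed_trancl:
  assumes "(u, v) \<in> (edges G)\<^sup>+" "down_closed G W" "v \<in> W"
  shows "u \<in> W"
  using assms by (induction rule: converse_trancl_induct) (auto simp: down_closed_def)

definition loaded :: "'v move list \<Rightarrow> 'v set" where
  "loaded ms = {v. Load v \<in> set ms}"

lemma loaded_eq: "loaded ms = (\<lambda>m. case m of Load v \<Rightarrow> v | Spill v \<Rightarrow> v | Compute v \<Rightarrow> v)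
    ` set (filter (\<lambda>m. \<exists>v. m = Load v) ms)"
  unfolding loaded_def by (force simp: image_iff)

lemma finite_loaded: "finite (loaded ms)"
  by (simp add: loaded_eq)

lemma card_loaded_le: "card (loaded ms) \<le> loads ms"
  unfolding loaded_eq loads_def by (meson List.finite_set card_image_le card_length le_trans)

lemma loads_append: "loads (xs @ ys) = loads xs + loads ys"
  by (simp add: loads_def)

lemma split_at_loads:
  assumes "k \<le> loads ms"
  shows "\<exists>xs ys. ms = xs @ ys \<and> loads xs = k"
  using assms
proof (induction ms arbitrary: k)
  case Nil
  then show ?case by (simp add: loads_def)
next
  case (Cons m ms)
  show ?case
  proof (cases "k = 0")
    case True
    then have "m # ms = [] @ (m # ms) \<and> loads ([] :: 'a move list) = k"
      by (simp add: loads_def)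
    then show ?thesis by blast
  next
    case False
    define d where "d = (if \<exists>v. m = Load v then 1 else 0 :: nat)"
    have d: "loads (m # xs) = d + loads xs" for xs
      by (simp add: d_def loads_def)
    have "k - d \<le> loads ms"
      using Cons.prems d[of ms] by simp
    then obtain xs ys where "ms = xs @ ys" "loads xs = k - d"
      using Cons.IH by blast
    moreover have "d \<le> k"
      using False by (simp add: d_def)
    ultimately have "m # ms = (m # xs) @ ys \<and> loads (m # xs) = k"
      using d by simp
    then show ?thesis by blast
  qed
qed

definition valid_config :: "'v cdag \<Rightarrow> nat \<Rightarrow> 'v config \<Rightarrow> bool" where
  "valid_config G S c \<longleftrightarrow>
     finite (fst c) \<and> card (fst c) \<le> S \<and> fst c \<subseteq> snd c \<and> down_closed G (snd c)"

lemma valid_config_initial: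
  assumes "\<And>u v. (u, v) \<in> edges G \<Longrightarrow> v \<notin> inputs G"
  shows "valid_config G S (initial G)"
  using assms by (auto simp: valid_config_def initial_def down_closed_def)

lemma valid_config_foldl:
  assumes "legal G S c ms" "valid_config G S c"
  shows "valid_config G S (foldl apply_move c ms)"
  using assms
proof (induction ms arbitrary: c)
  case (Cons m ms)
  obtain R W where c: "c = (R, W)" by fastforce
  have "valid_config G S (apply_move c m)"
    using Cons.prems unfolding c
    by (cases m) (auto simp: valid_config_def down_closed_def preds_def)
  then show ?case
    using Cons by simp
qed simp

lemma legal_append:
  "legal G S c (xs @ ys) \<longleftrightarrow> legal G S c xs \<and> legal G S (foldl apply_move c xs) ys"
  by (induction xs arbitrary: c) auto

lemma white_apply: "snd (apply_move c m) = snd c \<union> {v. m = Compute v}"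
  by (cases c; cases m) auto

lemma red_apply: "fst (apply_move c m) \<subseteq> fst c \<union> {v. m = Compute v \<or> m = Load v}"
  by (cases c; cases m) auto

lemma white_mono: "snd c \<subseteq> snd (foldl apply_move c ms)"
proof (induction ms arbitrary: c)
  case (Cons m ms)
  then show ?case
    using Cons[of "apply_move c m"] by (auto simp: white_apply)
qed simp

text \<open>A predecessor is red when \<open>v\<close> is computed, so it was red at the start, or
  loaded or computed since then.\<close>

lemma preds_computed:
  assumes "legal G S c ms" "v \<in> snd (foldl apply_move c ms) - snd c"
  shows "preds G v \<subseteq> (snd (foldl apply_move c ms) - snd c) \<union> (fst c \<union> loaded ms)"
  using assms
proof (induction ms arbitrary: c)
  case (Cons m ms)
  let ?c = "apply_move c m"
  let ?W = "snd (foldl apply_move c (m # ms))"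
  obtain R W where c: "c = (R, W)" by fastforce
  have mono: "snd ?c \<subseteq> ?W"
    using white_mono[of ?c ms] by simp
  have new: "u \<in> ?W - W" if "m = Compute u" for u
    using that Cons.prems(1) mono by (auto simp: c)
  show ?case
  proof (cases "m = Compute v")
    case True
    then show ?thesis
      using Cons.prems(1) by (auto simp: c)
  next
    case False
    then have "v \<in> snd (foldl apply_move ?c ms) - snd ?c"
      using Cons.prems(2) by (auto simp: white_apply)
    then have "preds G v \<subseteq> (?W - snd ?c) \<union> (fst ?c \<union> loaded ms)"
      using Cons.IH[of ?c] Cons.prems(1) by simp
    also have "\<dots> \<subseteq> (?W - W) \<union> (R \<union> loaded (m # ms))"
      using red_apply[of c m] new by (auto simp: c white_apply loaded_def)
    finally show ?thesis by (simp add: c)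
  qed
qed simp

text \<open>A segment with at most \<open>T\<close> loads has at most \<open>S + T\<close> operands from outside: those with a
  red pebble at its start and those loaded during it.\<close>

lemma card_computed_le:
  fixes T :: nat and U :: real
  assumes seg: "\<And>W W' P. down_closed G W \<Longrightarrow> down_closed G W' \<Longrightarrow> W \<subseteq> W' \<Longrightarrow> finite P \<Longrightarrow>
      card P \<le> S + T \<Longrightarrow> (\<And>v. v \<in> W' - W \<Longrightarrow> preds G v \<subseteq> (W' - W) \<union> P) \<Longrightarrow>
      card (D \<inter> (W' - W)) \<le> U"
    and "0 < T" "finite D"
    and "legal G S c ms" "valid_config G S c"
  shows "card (D \<inter> (snd (foldl apply_move c ms) - snd c)) \<le> (loads ms / T + 1) * U"
  using assms(4,5)
proof (induction "loads ms" arbitrary: c ms rule: less_induct)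
  case less
  have short: "card (D \<inter> (snd (foldl apply_move c xs) - snd c)) \<le> U"
    if "legal G S c xs" "loads xs \<le> T" for xs
  proof (rule seg)
    show "down_closed G (snd c)" "down_closed G (snd (foldl apply_move c xs))"
      using less.prems(2) valid_config_foldl[OF that(1)] by (auto simp: valid_config_def)
    show "finite (fst c \<union> loaded xs)"
      using less.prems(2) by (simp add: valid_config_def finite_loaded)
    have "card (fst c \<union> loaded xs) \<le> card (fst c) + card (loaded xs)"
      by (rule card_Un_le)
    also have "\<dots> \<le> S + T"
      using less.prems(2) that(2) card_loaded_le[of xs] by (simp add: valid_config_def)
    finally show "card (fst c \<union> loaded xs) \<le> S + T" .
    show "snd c \<subseteq> snd (foldl apply_move c xs)"
      by (rule white_mono)
  qed (rule preds_computed[OF that(1)])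
  have "0 \<le> U"
    using short[of "[]"] by (simp add: loads_def)
  show ?case
  proof (cases "loads ms \<le> T")
    case True
    have "U \<le> (loads ms / T + 1) * U"
      using \<open>0 \<le> U\<close> by (simp add: distrib_right)
    then show ?thesis
      using short[OF less.prems(1) True] by linarith
  next
    case False
    \<comment> \<open>Cut off a first segment with exactly \<open>T\<close> loads; as
      \<open>0 < T\<close>, the rest has fewer loads.\<close>
    then obtain xs ys where ms: "ms = xs @ ys" and xs: "loads xs = T"
      using split_at_loads[of T ms] by auto
    let ?c = "foldl apply_move c xs"
    have leg: "legal G S c xs" "legal G S ?c ys"
      using less.prems(1) by (auto simp: ms legal_append)
    have "loads ys < loads ms"
      using xs \<open>0 < T\<close> by (simp add: ms loads_append)
    then have 2: "card (D \<inter> (snd (foldl apply_move ?c ys) - snd ?c)) \<le> (loads ys / T + 1) * U"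
      using less.hyps leg valid_config_foldl[OF leg(1) less.prems(2)] by blast
    have "card (D \<inter> (snd (foldl apply_move c ms) - snd c)) \<le>
        card (D \<inter> (snd ?c - snd c) \<union> D \<inter> (snd (foldl apply_move ?c ys) - snd ?c))"
      using \<open>finite D\<close> by (intro card_mono) (auto simp: ms)
    also have "\<dots> \<le> card (D \<inter> (snd ?c - snd c))
        + card (D \<inter> (snd (foldl apply_move ?c ys) - snd ?c))"
      by (rule card_Un_le)
    finally have "card (D \<inter> (snd (foldl apply_move c ms) - snd c)) \<le> U + (loads ys / T + 1) * U"
      using 2 short[OF leg(1)] xs by linarith
    also have "\<dots> = (loads ms / T + 1) * U"
      using \<open>0 < T\<close> xs by (simp add: ms loads_append field_simps)
    finally show ?thesis .
  qed
qed

section \<open>Flow dependences in a sorted trace\<close>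

fun node_loc :: "'l node \<Rightarrow> 'l" where
  "node_loc (Input x) = x"
| "node_loc (Inst v) = lhs v"

text \<open>A strictly increasing key turns positions in the trace into inequalities.\<close>

locale sorted_trace =
  fixes tr :: "'l inst list" and key :: "'l inst \<Rightarrow> 'k::linorder"
  assumes sorted: "sorted_wrt (\<lambda>u v. key u < key v) tr"
begin

abbreviation reach :: "('l node \<times> 'l node) set" where
  "reach \<equiv> (edges (cdag_of tr))\<^sup>+"

lemma split_trace:
  assumes "v \<in> set tr"
  obtains xs ys where "tr = xs @ v # ys" "set xs = {w \<in> set tr. key w < key v}"
proof -
  obtain xs ys where tr: "tr = xs @ v # ys"
    using assms by (meson split_list)
  have "set xs = {w \<in> set tr. key w < key v}"
    using sorted by (force simp: tr sorted_wrt_append)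
  with tr that show ?thesis by blast
qed

lemma reads_inputI:
  assumes "v \<in> set tr" "x \<in> rhs v" "\<And>w. w \<in> set tr \<Longrightarrow> key w < key v \<Longrightarrow> lhs w \<noteq> x"
  shows "reads_input tr x v"
  unfolding reads_input_def using assms by (metis (no_types, lifting) mem_Collect_eq split_trace)

lemma edge_instI:
  assumes "u \<in> set tr" "v \<in> set tr" "key u < key v" "lhs u \<in> rhs v"
    and "\<And>w. w \<in> set tr \<Longrightarrow> key u < key w \<Longrightarrow> key w < key v \<Longrightarrow> lhs w \<noteq> lhs u"
  shows "(Inst u, Inst v) \<in> edges (cdag_of tr)"
proof -
  obtain xs zs where tr: "tr = xs @ v # zs" and xs: "set xs = {w \<in> set tr. key w < key v}"
    using split_trace[OF assms(2)] by blast
  have "u \<in> set xs" using assms(1,3) xs by simp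
  then obtain ws ys where ws: "xs = ws @ u # ys" by (meson split_list)
  have "lhs w \<noteq> lhs u" if "w \<in> set ys" for w
    using sorted that assms(5)[of w] xs by (auto simp: tr ws sorted_wrt_append)
  then have "flow_dep tr u v"
    unfolding flow_dep_def using tr ws assms(4) by auto
  then show ?thesis by (simp add: cdag_of_def)
qed

text \<open>Writes in between do not break the dependence if they read the old value: the path then
  passes through them.\<close>

lemma reachI:
  assumes "u \<in> set tr" "v \<in> set tr" "key u < key v" "lhs u \<in> rhs v"
    and "\<And>w. w \<in> set tr \<Longrightarrow> key u < key w \<Longrightarrow> key w < key v \<Longrightarrow> lhs w = lhs u \<Longrightarrow> lhs u \<in> rhs w"
  shows "(Inst u, Inst v) \<in> reach"
  using assms
proof (induction "card {w \<in> set tr. key u < key w \<and> key w < key v}" arbitrary: u v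
    rule: less_induct)
  case less
  show ?case
  proof (cases "\<exists>w \<in> set tr. key u < key w \<and> key w < key v \<and> lhs w = lhs u")
    case True
    then obtain w where w: "w \<in> set tr" "key u < key w" "key w < key v" "lhs w = lhs u" by blast
    have "(Inst u, Inst w) \<in> reach"
      using less.prems w by (intro less.hyps psubset_card_mono) auto
    moreover have "(Inst w, Inst v) \<in> reach"
      using less.prems w by (intro less.hyps psubset_card_mono) auto
    ultimately show ?thesis by simp
  next
    case False
    then show ?thesis
      using less.prems by (intro r_into_trancl edge_instI) auto
  qed
qed

lemma pred_cases:
  assumes "v \<in> set tr" "x \<in> rhs v"
  obtains "(Input x, Inst v) \<in> edges (cdag_of tr)" "Input x \<in> inputs (cdag_of tr)"
  | u where "(Inst u, Inst v) \<in> edges (cdag_of tr)" "u \<in> set tr" "lhs u = x" "key u < key v"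
proof (cases "\<exists>u \<in> set tr. key u < key v \<and> lhs u = x")
  case False
  then have "reads_input tr x v"
    using assms by (intro reads_inputI) auto
  then show ?thesis
    by (intro that(1)) (auto simp: cdag_of_def)
next
  case True
  let ?B = "{u \<in> set tr. key u < key v \<and> lhs u = x}"
  have B: "finite (key ` ?B)" "key ` ?B \<noteq> {}"
    using True by auto
  then obtain u where u: "u \<in> ?B" "key u = Max (key ` ?B)"
    using Max_in[OF B] by (metis (no_types, lifting) imageE)
  have "key w \<le> key u" if "w \<in> ?B" for w
    using u(2) B(1) that by simp
  then have "(Inst u, Inst v) \<in> edges (cdag_of tr)"
    using u(1) assms by (intro edge_instI) fastforce+
  then show ?thesis
    using u(1) by (intro that(2)) auto
qed

text \<open>The last assumption ensures that the first access to \<open>x\<close> is a read.\<close>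

lemma input_read:
  assumes "v \<in> set tr" "x \<in> rhs v"
    and "\<And>w. w \<in> set tr \<Longrightarrow> lhs w = x \<Longrightarrow> x \<in> rhs w"
  obtains w where "reads_input tr x w"
proof -
  let ?B = "{u \<in> set tr. x \<in> rhs u}"
  have B: "finite (key ` ?B)" "key ` ?B \<noteq> {}"
    using assms(1,2) by auto
  then obtain u where u: "u \<in> ?B" "key u = Min (key ` ?B)"
    using Min_in[OF B] by (metis (no_types, lifting) imageE)
  have "key u \<le> key w" if "w \<in> ?B" for w
    using u(2) B(1) that by simp
  then have "reads_input tr x u"
    using u(1) assms(3) by (intro reads_inputI) fastforce+
  with that show ?thesis .
qed

end

section \<open>Dependences of the Hessenberg reduction\<close>

text \<open>Lexicographic order of these keys is execution order. Statements 7 and 8, and likewise 12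
  and 13, are interleaved and share the second component.\<close>

definition key :: "'l inst \<Rightarrow> nat \<times> nat \<times> nat \<times> nat" where
  "key v = (iter v ! 0,
     if stmt v = 8 then 7 else if stmt v = 13 then 12 else stmt v,
     if length (iter v) \<ge> 2 then iter v ! 1 else 0,
     if length (iter v) \<ge> 3 then Suc (iter v ! 2) else 0)"

lemma key_simps [simp]:
  "key (Stmt s [j] x X) = (j, if s = 8 then 7 else if s = 13 then 12 else s, 0, 0)"
  "key (Stmt s [j, i] x X) = (j, if s = 8 then 7 else if s = 13 then 12 else s, i, 0)"
  "key (Stmt s [j, i, k] x X) = (j, if s = 8 then 7 else if s = 13 then 12 else s, i, Suc k)"
  by (simp_all add: key_def)

lemma sorted_wrt_concat_map:
  assumes "sorted_wrt (<) xs" "\<And>x. x \<in> set xs \<Longrightarrow> sorted_wrt R (f x)"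
    and "\<And>x y u v. x \<in> set xs \<Longrightarrow> y \<in> set xs \<Longrightarrow> x < y \<Longrightarrow> u \<in> set (f x) \<Longrightarrow> v \<in> set (f y) \<Longrightarrow> R u v"
  shows "sorted_wrt R (concat (map f xs))"
  using assms
proof (induction xs)
  case (Cons a xs)
  then show ?case
    by (fastforce simp: sorted_wrt_append)
qed simp

lemma sorted_hess_step: "sorted_wrt (\<lambda>u v. key u < key v) (hess_step n j)"
proof -
  note upt = sorted_wrt_mono_rel[OF _ sorted_wrt_upt]
  \<comment> \<open>The loops have three shapes. In the interleaved ones, \<open>Suc k\<close> in
    the key puts the initialisation before the accumulation over \<open>k\<close>.\<close>
  have interleaved: "sorted_wrt (\<lambda>u v. key u < key v)
      (concat (map (\<lambda>i. Stmt s [j, i] (f i) (X i) #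
         map (\<lambda>k. Stmt s' [j, i, k] (f i) (Y i k)) [a..<n]) [b..<n]))"
    if "(s, s') \<in> {(7, 8), (12, 13)}" for s s' f X Y a b
    using that by (intro sorted_wrt_concat_map) (auto simp: sorted_wrt_map intro!: upt)
  have nested: "sorted_wrt (\<lambda>u v. key u < key v)
      (concat (map (\<lambda>i. map (\<lambda>k. Stmt s [j, i, k] (f i k) (X i k)) [a..<n]) [b..<n]))" for s f X a b
    by (intro sorted_wrt_concat_map) (auto simp: sorted_wrt_map intro!: upt)
  have single: "sorted_wrt (\<lambda>u v. key u < key v) (map (\<lambda>i. Stmt s [j, i] (f i) (X i)) [a..<n])"
    for s f X a
    by (auto simp: sorted_wrt_map intro!: upt)
  show ?thesis
    unfolding hess_step_def
    by (simp only: sorted_wrt_append interleaved nested single simp_thms, auto intro!: interleaved)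
qed

lemma fst_key_hess_step: "v \<in> set (hess_step n j) \<Longrightarrow> fst (key v) = j"
  by (auto simp: hess_step_def)

interpretation hess: sorted_trace "hessenberg n" key for n
proof
  show "sorted_wrt (\<lambda>u v. key u < key v) (hessenberg n)"
    unfolding hessenberg_def
    by (intro sorted_wrt_concat_map sorted_hess_step)
      (auto simp: less_prod_def dest!: fst_key_hess_step)
qed

abbreviation "graph n \<equiv> cdag_of (hessenberg n)"

text \<open>\<open>vec\<close> forms the Householder vector; \<open>dot0\<close>, \<open>dot\<close>
  and \<open>scal\<close> form row \<open>i\<close> of the matrix times that vector, scaled by
  \<open>Tau\<close>; \<open>col\<close> and \<open>upd\<close> subtract the rank-one
  correction.\<close>

abbreviation "vec j k \<equiv> Stmt 5 [j, k] (A k j) {A k j, A (Suc j) j}"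
abbreviation "dot j i k \<equiv> Stmt 13 [j, i, k] (Tmp i) {Tmp i, A i k, A k j}"
abbreviation "dot0 j i \<equiv> Stmt 12 [j, i] (Tmp i) {A i (Suc j)}"
abbreviation "scal j i \<equiv> Stmt 14 [j, i] (Tmp i) {Tmp i, Tau}"
abbreviation "col j i \<equiv> Stmt 15 [j, i] (A i (Suc j)) {A i (Suc j), Tmp i}"
abbreviation "upd j i k \<equiv> Stmt 16 [j, i, k] (A i k) {A i k, Tmp i, A k j}"

lemma set_hessenberg: "v \<in> set (hessenberg n) \<longleftrightarrow> (\<exists>j<n-2. v \<in> set (hess_step n j))"
  by (auto simp: hessenberg_def)

lemma mem_hessenberg:
  "vec j k \<in> set (hessenberg n) \<longleftrightarrow> j + 2 \<le> k \<and> k < n"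
  "upd j i k \<in> set (hessenberg n) \<longleftrightarrow> i < n \<and> j + 2 \<le> k \<and> k < n"
  "dot j i k \<in> set (hessenberg n) \<longleftrightarrow> i < n \<and> j + 2 \<le> k \<and> k < n"
  "dot0 j i \<in> set (hessenberg n) \<longleftrightarrow> i < n \<and> j + 2 < n"
  "scal j i \<in> set (hessenberg n) \<longleftrightarrow> i < n \<and> j + 2 < n"
  "col j i \<in> set (hessenberg n) \<longleftrightarrow> i < n \<and> j + 2 < n"
  unfolding set_hessenberg by (auto simp: hess_step_def image_iff)

text \<open>Array entries are only updated in place, so the successive values of an entry form one
  chain.\<close>

lemma writers_A_read:
  "w \<in> set (hessenberg n) \<Longrightarrow> lhs w = A i k \<Longrightarrow> A i k \<in> rhs w"
  unfolding set_hessenberg by (auto simp: hess_step_def)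

text \<open>Statements 7 and 12 overwrite \<open>Tmp i\<close> without reading it; the window of
  keys excludes both.\<close>

lemma writers_Tmp:
  assumes "w \<in> set (hessenberg n)" "lhs w = Tmp i" "(j, 12, i, 0) < key w" "key w < (j, 16, 0, 0)"
  shows "(\<exists>k. w = dot j i k) \<or> w = scal j i"
  using assms unfolding set_hessenberg by (auto simp: hess_step_def)

lemma writers_vec:
  assumes "w \<in> set (hessenberg n)" "lhs w = A k j" "key (vec j k) < key w" "fst (key w) = j"
    "j + 2 \<le> k"
  shows False
  using assms unfolding set_hessenberg by (auto simp: hess_step_def)

lemma reach_A:
  assumes "u \<in> set (hessenberg n)" "v \<in> set (hessenberg n)" "key u < key v"
    "lhs u = A i k" "A i k \<in> rhs v"
  shows "(Inst u, Inst v) \<in> hess.reach n"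
  using assms by (intro hess.reachI) (auto dest: writers_A_read)

section \<open>Dependence paths within and between iterations\<close>

lemma dot_scal:
  assumes "i < n" "j + 2 \<le> k" "k < n"
  shows "(Inst (dot j i k), Inst (scal j i)) \<in> hess.reach n"
proof (rule hess.reachI)
  fix w assume "w \<in> set (hessenberg n)" "key (dot j i k) < key w" "key w < key (scal j i)"
    "lhs w = lhs (dot j i k)"
  then have "(\<exists>k. w = dot j i k) \<or> w = scal j i"
    by (intro writers_Tmp) (auto simp: less_prod_def)
  then show "lhs (dot j i k) \<in> rhs w" by auto
qed (use assms in \<open>auto simp: mem_hessenberg\<close>)

lemma dot0_scal:
  assumes "i < n" "j + 2 < n"
  shows "(Inst (dot0 j i), Inst (scal j i)) \<in> hess.reach n"
proof (rule hess.reachI)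
  fix w assume "w \<in> set (hessenberg n)" "key (dot0 j i) < key w" "key w < key (scal j i)"
    "lhs w = lhs (dot0 j i)"
  then have "(\<exists>k. w = dot j i k) \<or> w = scal j i"
    by (intro writers_Tmp) (auto simp: less_prod_def)
  then show "lhs (dot0 j i) \<in> rhs w" by auto
qed (use assms in \<open>auto simp: mem_hessenberg\<close>)

lemma scal_upd:
  assumes "i < n" "j + 2 \<le> k" "k < n"
  shows "(Inst (scal j i), Inst (upd j i k)) \<in> hess.reach n"
proof (rule hess.reachI)
  fix w assume w: "w \<in> set (hessenberg n)" "key (scal j i) < key w" "key w < key (upd j i k)"
    "lhs w = lhs (scal j i)"
  then show "lhs (scal j i) \<in> rhs w"
    unfolding set_hessenberg by (auto simp: hess_step_def)
qed (use assms in \<open>auto simp: mem_hessenberg\<close>)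

lemma scal_col:
  assumes "i < n" "j + 2 < n"
  shows "(Inst (scal j i), Inst (col j i)) \<in> hess.reach n"
proof (rule hess.reachI)
  fix w assume w: "w \<in> set (hessenberg n)" "key (scal j i) < key w" "key w < key (col j i)"
    "lhs w = lhs (scal j i)"
  then show "lhs (scal j i) \<in> rhs w"
    unfolding set_hessenberg by (auto simp: hess_step_def)
qed (use assms in \<open>auto simp: mem_hessenberg\<close>)

text \<open>The next Householder vector is built from column \<open>j+1\<close>, as left by
  \<open>col\<close>.\<close>

lemma scal_vec:
  assumes "j + 3 \<le> i" "i < n"
  shows "(Inst (scal j i), Inst (vec (j+1) i)) \<in> hess.reach n"
proof (rule trancl_trans[OF scal_col])
  show "(Inst (col j i), Inst (vec (j+1) i)) \<in> hess.reach n"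
    using assms by (intro reach_A) (auto simp: mem_hessenberg)
qed (use assms in auto)

lemma vec_scal:
  assumes "i < n" "j + 2 \<le> k" "k < n"
  shows "(Inst (vec j k), Inst (scal j i)) \<in> hess.reach n"
proof (rule trancl_trans[OF _ dot_scal[OF assms]])
  show "(Inst (vec j k), Inst (dot j i k)) \<in> hess.reach n"
    using assms by (intro reach_A) (auto simp: mem_hessenberg)
qed

lemma upd_scal:
  assumes "i < n" "j + 2 \<le> k" "k < n" "j + 3 < n"
  shows "(Inst (upd j i k), Inst (scal (j+1) i)) \<in> hess.reach n"
proof (cases "k = j + 2")
  \<comment> \<open>Column \<open>j+2\<close> enters the next product as its initial term, later
    columns through the accumulation.\<close>
  case True
  have "(Inst (upd j i k), Inst (dot0 (j+1) i)) \<in> hess.reach n"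
    using assms True by (intro reach_A) (auto simp: mem_hessenberg)
  also have "(Inst (dot0 (j+1) i), Inst (scal (j+1) i)) \<in> hess.reach n"
    using assms by (intro dot0_scal) auto
  finally show ?thesis .
next
  case False
  have "(Inst (upd j i k), Inst (dot (j+1) i k)) \<in> hess.reach n"
    using assms False by (intro reach_A) (auto simp: mem_hessenberg)
  also have "(Inst (dot (j+1) i k), Inst (scal (j+1) i)) \<in> hess.reach n"
    using assms False by (intro dot_scal) auto
  finally show ?thesis .
qed

text \<open>The hourglass: all updates of a row in one iteration pass through a single \<open>Tmp\<close> value
  on their way to the updates of the same row in the next iteration.\<close>

lemma upd_upd:
  assumes "j < j'" "i < n" "j + 2 \<le> k" "k < n" "j' + 2 \<le> k'" "k' < n"
  shows "(Inst (upd j i k), Inst (upd j' i k')) \<in> hess.reach n"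
  using assms
proof (induction j' arbitrary: k' rule: less_induct)
  case (less j')
  then obtain m where j': "j' = Suc m" by (cases j') auto
  have *: "(Inst (upd m i l), Inst (upd j' i k')) \<in> hess.reach n" if "m + 2 \<le> l" "l < n" for l
    using upd_scal[of i n m l] scal_upd[of i n j' k'] that less.prems by (auto simp: j')
  show ?case
  proof (cases "j = m")
    case True
    then show ?thesis using * less.prems by auto
  next
    case False
    then have "(Inst (upd j i k), Inst (upd m i k')) \<in> hess.reach n"
      using less.prems by (intro less.IH) (auto simp: j')
    then show ?thesis
      using *[of k'] less.prems by (auto simp: j')
  qed
qed

text \<open>A direct edge matters here: only predecessors of nodes in a segment are known to be in
  it or among its outside operands.\<close>

lemma vec_upd_edge:
  assumes "i < n" "j + 2 \<le> k" "k < n"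
  shows "(Inst (vec j k), Inst (upd j i k)) \<in> edges (graph n)"
proof (rule hess.edge_instI)
  fix w assume "w \<in> set (hessenberg n)" "key (vec j k) < key w" "key w < key (upd j i k)"
  then show "lhs w \<noteq> lhs (vec j k)"
    using writers_vec[of w n k j] assms by (cases "key w") (auto simp: less_prod_def)
qed (use assms in \<open>auto simp: mem_hessenberg\<close>)

text \<open>All updates of iteration \<open>j\<close> in the rows \<open>i' \<ge> j + 4\<close> lie between \<open>vec j k\<close> and any update
  of iteration \<open>j + 2\<close> or later.\<close>

lemma vec_upd_upd:
  assumes "j + 2 \<le> k" "k < n" "j + 4 \<le> i'" "i' < n" "j + 2 \<le> k'" "k' < n"
    and "i < n" "j + 2 \<le> b" "b + 2 \<le> l" "l < n"
  shows "(Inst (vec j k), Inst (upd j i' k')) \<in> hess.reach n"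
    and "(Inst (upd j i' k'), Inst (upd b i l)) \<in> hess.reach n"
proof -
  show "(Inst (vec j k), Inst (upd j i' k')) \<in> hess.reach n"
    using assms by (intro trancl_trans[OF vec_scal scal_upd]) auto
  \<comment> \<open>The path changes from row \<open>i'\<close> to row \<open>i\<close> through the
    Householder vector of iteration \<open>j+2\<close>, whose computed entries are in the rows from
    \<open>j+4\<close> on.\<close>
  have "(Inst (upd j i' k'), Inst (scal (j+1) i')) \<in> hess.reach n"
    using assms by (intro upd_scal) auto
  also have "(Inst (scal (j+1) i'), Inst (vec (j+2) i')) \<in> hess.reach n"
    using scal_vec[of "j+1" i' n] assms by simp
  also have "(Inst (vec (j+2) i'), Inst (scal (j+2) i)) \<in> hess.reach n"
    using assms by (intro vec_scal) auto
  also have "(Inst (scal (j+2) i), Inst (upd (j+2) i l)) \<in> hess.reach n"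
    using assms by (intro scal_upd) auto
  finally have *: "(Inst (upd j i' k'), Inst (upd (j+2) i l)) \<in> hess.reach n" .
  show "(Inst (upd j i' k'), Inst (upd b i l)) \<in> hess.reach n"
  proof (cases "b = j + 2")
    case False
    then have "(Inst (upd (j+2) i l), Inst (upd b i l)) \<in> hess.reach n"
      using assms by (intro upd_upd) auto
    with * show ?thesis by simp
  qed (use * in simp)
qed

section \<open>Counting the updates of a segment\<close>

text \<open>Only \<open>Min J\<close>, \<open>Max J - 1\<close> and \<open>Max J\<close> can
  qualify. \<open>J\<close> will be the set of iterations in which a row is active.\<close>

lemma card_outer_le_3:
  fixes J :: "nat set"
  assumes "finite J"
  shows "card {j \<in> J. \<not> (\<exists>a \<in> J. \<exists>b \<in> J. a < j \<and> j + 1 < b)} \<le> 3"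
proof (cases "J = {}")
  case False
  have "j \<in> {Min J, Max J - 1, Max J}"
    if "j \<in> J" "\<not> (\<exists>a \<in> J. \<exists>b \<in> J. a < j \<and> j + 1 < b)" for j
  proof -
    have "Min J \<in> J" "Max J \<in> J" "Min J \<le> j" "j \<le> Max J"
      using assms False that by auto
    with that have "\<not> (Min J < j \<and> j + 1 < Max J)" by blast
    then show ?thesis using \<open>Min J \<le> j\<close> \<open>j \<le> Max J\<close> by auto
  qed
  then have "{j \<in> J. \<not> (\<exists>a \<in> J. \<exists>b \<in> J. a < j \<and> j + 1 < b)} \<subseteq> {Min J, Max J - 1, Max J}"
    by blast
  from card_mono[OF _ this] show ?thesis
    by (rule order_trans) (auto intro!: card_insert_le_m1)
qed simp

definition updates :: "nat \<Rightarrow> nat \<Rightarrow> loc node set" where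
  "updates n L = {Inst (upd j i k) |j i k. j < L \<and> i < n \<and> j + 2 \<le> k \<and> k < n}"

text \<open>The bound on \<open>card P\<close> keeps the segment from updating a whole block of
  \<open>n - L - 1\<close> rows and \<open>n - L + 1\<close> columns.\<close>

locale segment =
  fixes n L :: nat and W W' P :: "loc node set"
  assumes down_closed: "down_closed (graph n) W" "down_closed (graph n) W'"
    and subset: "W \<subseteq> W'"
    and finite_P: "finite P"
    and preds_subset: "\<And>v. v \<in> W' - W \<Longrightarrow> preds (graph n) v \<subseteq> (W' - W) \<union> P"
    and L: "L + 2 \<le> n"
    and card_P: "card P < (n - L - 1) * (n - L + 1)"
begin

definition "E = W' - W"

definition active :: "nat \<Rightarrow> nat \<Rightarrow> nat \<Rightarrow> bool" where
  "active j i k \<longleftrightarrow> j < L \<and> i < n \<and> j + 2 \<le> k \<and> k < n \<and> Inst (upd j i k) \<in> E"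

text \<open>The gap to \<open>b\<close> is at least two because a dependence needs two iterations to
  spread from one row to all rows.\<close>

definition inner :: "nat \<Rightarrow> nat \<Rightarrow> bool" where
  "inner j i \<longleftrightarrow> (\<exists>a b k l. active a i k \<and> active b i l \<and> a < j \<and> j + 1 < b)"

definition cells :: "(nat \<times> nat) set" where
  "cells = {(i, k). \<exists>j. active j i k}"

definition vecs :: "(nat \<times> nat) set" where
  "vecs = {(j, k). (\<exists>i. inner j i) \<and> j + 2 \<le> k \<and> k < n}"

definition rows :: "nat set" where
  "rows = {i. \<exists>j. inner j i}"

lemma convex:
  assumes "(u, x) \<in> hess.reach n" "(x, v) \<in> hess.reach n" "u \<in> E" "v \<in> E"
  shows "x \<in> E"
  using down_closed_trancl[OF assms(1) down_closed(1)] down_closed_trancl[OF assms(2) down_closed(2)]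
    assms(3,4) by (auto simp: E_def)

lemma inner_active:
  assumes "inner j i" "j + 2 \<le> k" "k < n"
  shows "active j i k"
proof -
  obtain a b l m where ab: "active a i l" "active b i m" "a < j" "j + 1 < b"
    using assms(1) unfolding inner_def by blast
  then have "Inst (upd j i k) \<in> E"
    using assms(2,3) by (intro convex[OF upd_upd[of a j i n l k] upd_upd[of j b i n k m]])
      (auto simp: active_def)
  then show ?thesis
    using assms(2,3) ab by (auto simp: active_def)
qed

lemma finite_cells: "finite cells"
  by (rule finite_subset[of _ "{..<n} \<times> {..<n}"]) (auto simp: cells_def active_def)

lemma finite_vecs: "finite vecs"
  by (rule finite_subset[of _ "{..<L} \<times> {..<n}"]) (auto simp: vecs_def inner_def active_def)

lemma finite_rows: "finite rows"
  by (rule finite_subset[of _ "{..<n}"]) (auto simp: rows_def inner_def active_def)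

text \<open>The chain of values of a memory cell starts outside of the segment, so each cell that the
  segment updates has to be supplied from \<open>P\<close>.\<close>

lemma cell_in_P:
  assumes "(i, k) \<in> cells"
  shows "\<exists>p \<in> P. node_loc p = A i k \<and> (\<forall>j' k'. p \<noteq> Inst (vec j' k'))"
proof -
  obtain j where j: "active j i k"
    using assms by (auto simp: cells_def)
  define B where "B = {w \<in> set (hessenberg n). Inst w \<in> E \<and> lhs w = A i k \<and> key w \<le> key (upd j i k)}"
  have "upd j i k \<in> B"
    using j by (auto simp: B_def active_def mem_hessenberg)
  then have "key ` B \<noteq> {}"
    by blast
  moreover have "finite B"
    by (simp add: B_def)
  ultimately have B: "finite (key ` B)" "key ` B \<noteq> {}"
    by simp_all
  \<comment> \<open>The earliest write of the cell in the segment: the value that it overwrites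
    comes from outside.\<close>
  then obtain w where w: "w \<in> B" "key w = Min (key ` B)"
    using Min_in[OF B] by (metis imageE)
  have min: "key w \<le> key u" if "u \<in> B" for u
    using w(2) B(1) that by simp
  have mem: "w \<in> set (hessenberg n)" and lhs: "lhs w = A i k" and wE: "Inst w \<in> E"
    and le: "key w \<le> key (upd j i k)"
    using w(1) by (auto simp: B_def)
  have P: "p \<in> P" if "(p, Inst w) \<in> edges (graph n)" "p \<notin> E" for p
    using preds_subset[of "Inst w"] wE that by (auto simp: preds_def E_def)
  show ?thesis
  proof (cases rule: hess.pred_cases[OF mem writers_A_read[OF mem lhs]])
    case 1
    then have "Input (A i k) \<notin> E"
      using down_closed(1) by (auto simp: E_def down_closed_def)
    then show ?thesis
      using P[OF 1(1)] by (intro bexI[of _ "Input (A i k)"]) auto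
  next
    case (2 u)
    have "Inst u \<notin> E"
    proof
      assume "Inst u \<in> E"
      then have "u \<in> B"
        using 2 le by (auto simp: B_def)
      then show False
        using min 2(4) by fastforce
    qed
    \<comment> \<open>Column \<open>k\<close> turns into a Householder vector only in iteration
      \<open>k\<close>, which comes after iteration \<open>j\<close>.\<close>
    moreover have "u \<noteq> vec j' k'" for j' k'
    proof
      assume u: "u = vec j' k'"
      have "key u < key (upd j i k)"
        using 2(4) le by simp
      then have "k \<le> j"
        using 2(3) by (auto simp: u less_prod_def)
      then show False
        using j by (auto simp: active_def)
    qed
    ultimately show ?thesis
      using P[OF 2(1)] 2(3) by (intro bexI[of _ "Inst u"]) auto
  qed
qed

text \<open>Suppliers of different cells have different locations. Avoiding \<open>vec\<close> nodes
  leaves those to be counted separately.\<close>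

lemma cells_injection:
  obtains f where "inj_on f cells" "f ` cells \<subseteq> P" "\<And>j k. Inst (vec j k) \<notin> f ` cells"
proof -
  have "\<forall>c \<in> cells. \<exists>p. p \<in> P \<and> node_loc p = A (fst c) (snd c) \<and>
      (\<forall>j k. p \<noteq> Inst (vec j k))"
    using cell_in_P by (metis prod.collapse)
  from bchoice[OF this] obtain f where f: "\<And>c. c \<in> cells \<Longrightarrow> f c \<in> P"
      "\<And>c. c \<in> cells \<Longrightarrow> node_loc (f c) = A (fst c) (snd c)"
      "\<And>c j k. c \<in> cells \<Longrightarrow> f c \<noteq> Inst (vec j k)"
    by blast
  show ?thesis
  proof (rule that)
    show "inj_on f cells"
    proof (rule inj_onI)
      fix c d assume cd: "c \<in> cells" "d \<in> cells" "f c = f d"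
      then have "A (fst c) (snd c) = A (fst d) (snd d)"
        using f(2)[of c] f(2)[of d] by simp
      then show "c = d"
        by (simp add: prod_eq_iff)
    qed
    show "f ` cells \<subseteq> P"
      using f(1) by blast
    show "Inst (vec j k) \<notin> f ` cells" for j k
      using f(3) by (metis imageE)
  qed
qed

text \<open>Otherwise the segment would contain almost an entire iteration, which has too many cells.\<close>

lemma vec_notin_E:
  assumes "active b i l" "j + 2 \<le> b" "j + 2 \<le> k" "k < n"
  shows "Inst (vec j k) \<notin> E"
proof
  assume vec: "Inst (vec j k) \<in> E"
  have b: "b < L" "i < n" "b + 2 \<le> l" "l < n" "Inst (upd b i l) \<in> E"
    using assms(1) by (auto simp: active_def)
  have "{j+4..<n} \<times> {j+2..<n} \<subseteq> cells"
  proof clarsimp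
    fix i' k'
    assume "j + 4 \<le> i'" "i' < n" "Suc (Suc j) \<le> k'" "k' < n"
    then have "active j i' k'"
      using convex[OF vec_upd_upd[of j k n i' k' i b l] vec b(5)] assms b
      by (auto simp: active_def)
    then show "(i', k') \<in> cells"
      by (auto simp: cells_def)
  qed
  then have "card ({j+4..<n} \<times> {j+2..<n}) \<le> card cells"
    by (intro card_mono finite_cells)
  also have "card cells \<le> card P"
    using cells_injection card_inj_on_le finite_P by metis
  finally have "(n - (j + 4)) * (n - (j + 2)) \<le> card P"
    by simp
  \<comment> \<open>Here \<open>j + 3 \<le> L\<close>, by \<open>j + 2 \<le> b\<close> and
    \<open>b < L\<close>.\<close>
  moreover have "(n - L - 1) * (n - L + 1) \<le> (n - (j + 4)) * (n - (j + 2))"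
    using assms(2) b(1) L by (intro mult_mono) auto
  ultimately show False
    using card_P by linarith
qed

text \<open>Suppliers of cells and the entries in \<open>vecs\<close> are disjoint parts of
  \<open>P\<close>: the latter are operands of the segment but not computed in it.\<close>

lemma card_cells_vecs: "card cells + card vecs \<le> card P"
proof -
  obtain f where f: "inj_on f cells" "f ` cells \<subseteq> P" "\<And>j k. Inst (vec j k) \<notin> f ` cells"
    by (rule cells_injection) blast
  define g where "g = (\<lambda>(j, k). Inst (vec j k))"
  have "g ` vecs \<subseteq> P"
  proof clarsimp
    fix j k assume "(j, k) \<in> vecs"
    then obtain i where i: "inner j i" "j + 2 \<le> k" "k < n"
      by (auto simp: vecs_def)
    then obtain b l where b: "active b i l" "j + 2 \<le> b"
      by (auto simp: inner_def)
    have "active j i k"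
      using inner_active i by blast
    then have "Inst (upd j i k) \<in> W' - W" "(Inst (vec j k), Inst (upd j i k)) \<in> edges (graph n)"
      by (auto simp: active_def E_def intro!: vec_upd_edge[simplified])
    then have "Inst (vec j k) \<in> E \<union> P"
      using preds_subset by (auto simp: preds_def E_def)
    then show "g (j, k) \<in> P"
      using vec_notin_E[OF b i(2,3)] by (auto simp: g_def)
  qed
  moreover have "f ` cells \<inter> g ` vecs = {}"
    using f(3) by (force simp: g_def)
  ultimately have "card (f ` cells) + card (g ` vecs) \<le> card P"
    using f(2) finite_P finite_cells finite_vecs
    by (metis Un_subset_iff card_Un_disjoint card_mono finite_imageI)
  moreover have "inj_on g vecs"
    by (auto simp: inj_on_def g_def)
  ultimately show ?thesis
    using f(1) by (simp add: card_image)
qed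

text \<open>Such a row has an inner iteration \<open>j \<le> L - 3\<close>, so all its cells from
  column \<open>L - 1\<close> on are updated.\<close>

lemma card_rows: "(n - L + 1) * card rows \<le> card cells"
proof -
  have "rows \<times> {L-1..<n} \<subseteq> cells"
  proof clarsimp
    fix i k assume i: "i \<in> rows" and k: "L - Suc 0 \<le> k" "k < n"
    then obtain j where j: "inner j i"
      by (auto simp: rows_def)
    then have "j + 3 \<le> L"
      by (auto simp: inner_def active_def)
    then have "active j i k"
      using inner_active[OF j] k by simp
    then show "(i, k) \<in> cells"
      by (auto simp: cells_def)
  qed
  then have "card (rows \<times> {L-1..<n}) \<le> card cells"
    by (intro card_mono finite_cells)
  \<comment> \<open>For \<open>L = 0\<close> the subtraction \<open>L - 1\<close> truncates, but
    then \<open>rows\<close> is empty.\<close>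
  moreover have "n - L + 1 \<le> n - (L - 1)" if "rows \<noteq> {}"
  proof -
    have "0 < L"
      using that by (auto simp: rows_def inner_def active_def)
    then show ?thesis
      using L by simp
  qed
  then have "(n - L + 1) * card rows \<le> (n - (L - 1)) * card rows"
    by (cases "rows = {}") (simp, metis mult_le_mono1)
  ultimately show ?thesis
    by (simp add: card_cartesian_product mult.commute)
qed

text \<open>Each cell has at most three outer iterations; an inner update is determined by its row
  and the vector entry that it uses.\<close>

lemma card_active_le: "card (updates n L \<inter> E) \<le> 3 * card cells + card rows * card vecs"
proof -
  let ?lev = "\<lambda>i k. {j. active j i k \<and> \<not> inner j i}"
  let ?O = "Sigma cells (\<lambda>(i, k). ?lev i k)"
  have lev: "finite (?lev i k)" "card (?lev i k) \<le> 3" for i k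
  proof -
    let ?J = "{j. \<exists>k. active j i k}"
    have J: "finite ?J"
      by (rule finite_subset[of _ "{..<L}"]) (auto simp: active_def)
    have *: "?lev i k \<subseteq> {j \<in> ?J. \<not> (\<exists>a \<in> ?J. \<exists>b \<in> ?J. a < j \<and> j + 1 < b)}"
      by (auto simp: inner_def)
    then show "finite (?lev i k)"
      using J by (auto intro: finite_subset)
    show "card (?lev i k) \<le> 3"
      using card_mono[OF _ *] card_outer_le_3[OF J] J by (simp add: order_trans)
  qed
  have "card ?O = (\<Sum>c\<in>cells. card (case c of (i, k) \<Rightarrow> ?lev i k))"
    using lev(1) by (intro card_SigmaI finite_cells) auto
  also have "\<dots> \<le> (\<Sum>c\<in>cells. 3)"
    using lev(2) by (intro sum_mono) auto
  finally have O: "card ?O \<le> 3 * card cells"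
    by simp
  have fin: "finite ?O"
    using lev(1) by (intro finite_SigmaI finite_cells) auto
  have "updates n L \<inter> E \<subseteq> (\<lambda>((i, k), j). Inst (upd j i k)) ` ?O
      \<union> (\<lambda>(i, j, k). Inst (upd j i k)) ` (rows \<times> vecs)"
  proof clarsimp
    fix v assume v: "v \<in> updates n L" "v \<in> E"
      and nv: "v \<notin> (\<lambda>(i, j, k). Inst (upd j i k)) ` (rows \<times> vecs)"
    obtain j i k where jik: "v = Inst (upd j i k)" "active j i k"
      using v by (auto simp: updates_def active_def)
    have "\<not> inner j i"
    proof
      assume "inner j i"
      then have "(i, j, k) \<in> rows \<times> vecs"
        using jik(2) by (auto simp: rows_def vecs_def active_def)
      then show False
        using nv jik(1) by (force simp: image_iff)
    qed
    then have "((i, k), j) \<in> ?O"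
      using jik(2) by (auto simp: cells_def)
    then show "v \<in> (\<lambda>((i, k), j). Inst (upd j i k)) ` ?O"
      using jik(1) by (force simp: image_iff)
  qed
  then have "card (updates n L \<inter> E) \<le> card ((\<lambda>((i, k), j). Inst (upd j i k)) ` ?O
      \<union> (\<lambda>(i, j, k). Inst (upd j i k)) ` (rows \<times> vecs))"
    using fin finite_rows finite_vecs by (intro card_mono) auto
  also have "\<dots> \<le> card ((\<lambda>((i, k), j). Inst (upd j i k)) ` ?O)
      + card ((\<lambda>(i, j, k). Inst (upd j i k)) ` (rows \<times> vecs))"
    by (rule card_Un_le)
  also have "\<dots> \<le> card ?O + card (rows \<times> vecs)"
    using fin finite_rows finite_vecs by (intro add_mono card_image_le) auto
  finally show ?thesis
    using O by (simp add: card_cartesian_product)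
qed

text \<open>Multiplied by \<open>w = n - L + 1\<close>, the count is at most
  \<open>c * (v + 3 * w)\<close>, to which \<open>4 * (x * y) \<le> (x + y)^2\<close>
  applies.\<close>

lemma updates_bound:
  "4 * ((n - L + 1) * card (updates n L \<inter> E)) \<le> (card P + 3 * (n - L + 1))\<^sup>2"
proof -
  let ?w = "n - L + 1" and ?c = "card cells" and ?v = "card vecs"
  have "?w * card (updates n L \<inter> E) \<le> ?w * (3 * ?c + card rows * ?v)"
    by (intro mult_le_mono2 card_active_le)
  also have "\<dots> = 3 * ?w * ?c + (?w * card rows) * ?v"
    by (simp add: algebra_simps)
  also have "\<dots> \<le> 3 * ?w * ?c + ?c * ?v"
    using card_rows by (intro add_left_mono mult_le_mono1)
  finally have "4 * (?w * card (updates n L \<inter> E)) \<le> 4 * (?c * (?v + 3 * ?w))"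
    by (simp add: algebra_simps)
  also have "\<dots> \<le> (?c + (?v + 3 * ?w))\<^sup>2"
  proof -
    have "4 * (x * y) \<le> (x + y)\<^sup>2" for x y :: int
      using zero_le_power2[of "x - y"] by (simp add: power2_eq_square algebra_simps)
    from this[of "int ?c" "int (?v + 3 * ?w)"] show ?thesis
      by (metis (mono_tags, lifting) of_nat_add of_nat_le_iff of_nat_mult of_nat_numeral of_nat_power)
  qed
  also have "\<dots> \<le> (card P + 3 * ?w)\<^sup>2"
    using card_cells_vecs by (intro power_mono) auto
  finally show ?thesis .
qed

end

section \<open>The lower bound\<close>

lemma edges_not_into_inputs: "(u, v) \<in> edges (cdag_of tr) \<Longrightarrow> v \<notin> inputs (cdag_of tr)"
  by (auto simp: cdag_of_def)

lemma card_updates: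
  assumes "L + 2 \<le> n"
  shows "2 * card (updates n L) = n * L * (2 * n - 3 - L)"
proof -
  let ?I = "SIGMA j:{..<L}. {..<n} \<times> {j+2..<n}"
  have "updates n L = (\<lambda>(j, i, k). Inst (upd j i k)) ` ?I"
    by (force simp: updates_def image_iff)
  moreover have "inj_on (\<lambda>(j, i, k). Inst (upd j i k)) ?I"
    by (auto simp: inj_on_def)
  ultimately have "card (updates n L) = (\<Sum>j<L. n * (n - (j + 2)))"
    by (simp add: card_image)
  moreover have "2 * (\<Sum>j<L. n * (n - (j + 2))) = n * L * (2 * n - 3 - L)"
    using assms
  proof (induction L)
    case (Suc L)
    then obtain d where "n = L + 3 + d"
      using le_Suc_ex[of "L + 3" n] by auto
    then show ?case
      using Suc by (simp add: algebra_simps)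
  qed simp
  ultimately show ?thesis by simp
qed

lemma finite_updates: "finite (updates n L)"
proof -
  have "updates n L \<subseteq> (\<lambda>(j, i, k). Inst (upd j i k)) ` ({..<L} \<times> {..<n} \<times> {..<n})"
    by (force simp: updates_def image_iff)
  then show ?thesis
    by (rule finite_subset) simp
qed

section \<open>Loads of the inputs\<close>

lemma A_read:
  assumes "3 \<le> n" "i < n" "k < n" "(i, k) \<noteq> (0, 0)"
  shows "\<exists>v \<in> set (hessenberg n). A i k \<in> rhs v"
proof -
  consider "k = 0" "i = 1" | "k = 0" "2 \<le> i" | "k = 1" | "2 \<le> k"
    using assms(4) by fastforce
  then show ?thesis
  proof cases
    case 1
    then show ?thesis
      using assms(1) by (intro bexI[of _ "vec 0 2"]) (auto simp: mem_hessenberg)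
  next
    case 2
    then show ?thesis
      using assms(2) by (intro bexI[of _ "vec 0 i"]) (auto simp: mem_hessenberg)
  next
    case 3
    then show ?thesis
      using assms(1,2) by (intro bexI[of _ "dot0 0 i"]) (auto simp: mem_hessenberg)
  next
    case 4
    then show ?thesis
      using assms(2,3) by (intro bexI[of _ "dot 0 i k"]) (auto simp: mem_hessenberg)
  qed
qed

text \<open>Inputs are white from the start and never computed, so each one that is read must be
  loaded.\<close>

lemma loads_ge_inputs:
  assumes "3 \<le> n" "complete_game (graph n) S ms"
  shows "n\<^sup>2 - 1 \<le> loads ms"
proof -
  let ?G = "graph n"
  let ?I = "{..<n} \<times> {..<n} - {(0, 0)}"
  have legal: "legal ?G S (initial ?G) ms"
    and complete: "nodes ?G \<subseteq> snd (foldl apply_move (initial ?G) ms)"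
    using assms(2) by (auto simp: complete_game_def)
  have in_loaded: "Input (A i k) \<in> loaded ms" if ik: "(i, k) \<in> ?I" for i k
  proof -
    obtain v where "v \<in> set (hessenberg n)" "A i k \<in> rhs v"
      using A_read assms(1) ik by blast
    then obtain w where w: "reads_input (hessenberg n) (A i k) w"
      using hess.input_read writers_A_read by blast
    then have "Inst w \<in> nodes ?G" "Inst w \<notin> inputs ?G"
      and edge: "Input (A i k) \<in> preds ?G (Inst w)" "Input (A i k) \<in> inputs ?G"
      by (auto simp: cdag_of_def reads_input_def preds_def)
    then have "Inst w \<in> snd (foldl apply_move (initial ?G) ms) - snd (initial ?G)"
      using complete by (auto simp: initial_def)
    from preds_computed[OF legal this] edge show ?thesis
      by (auto simp: initial_def)
  qed
  have "(\<lambda>(i, k). Input (A i k)) ` ?I \<subseteq> loaded ms"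
  proof (rule image_subsetI)
    fix c assume "c \<in> ?I"
    then show "(case c of (i, k) \<Rightarrow> Input (A i k)) \<in> loaded ms"
      using in_loaded[of "fst c" "snd c"] by (simp add: split_beta)
  qed
  then have "card ((\<lambda>(i, k). Input (A i k)) ` ?I) \<le> card (loaded ms)"
    by (intro card_mono finite_loaded)
  moreover have "inj_on (\<lambda>(i, k). Input (A i k)) ?I"
    by (auto simp: inj_on_def)
  moreover have "card ?I = n\<^sup>2 - 1"
    using assms(1) by (subst card_Diff_singleton) (auto simp: power2_eq_square)
  ultimately show ?thesis
    using card_loaded_le[of ms] by (simp add: card_image)
qed

text \<open>The segment length \<open>T\<close> is chosen such that \<open>S + T + 3 * (n - L + 1) = 2 * T\<close>.\<close>

lemma loads_lower_bound:
  fixes n L S T :: nat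
  assumes "complete_game (graph n) S ms" "L + 2 \<le> n"
    and T: "T = S + 3 * (n - L + 1)"
    and ST: "S + T < (n - L - 1) * (n - L + 1)"
  shows "(n - L + 1) * card (updates n L) \<le> (loads ms + T) * T"
proof -
  let ?G = "graph n" and ?w = "n - L + 1"
  let ?W = "snd (foldl apply_move (initial ?G) ms)"
  have legal: "legal ?G S (initial ?G) ms" and complete: "nodes ?G \<subseteq> ?W"
    using assms(1) by (auto simp: complete_game_def)
  have "updates n L \<subseteq> ?W - snd (initial ?G)"
  proof -
    have "updates n L \<subseteq> Inst ` set (hessenberg n)"
      by (auto simp: updates_def mem_hessenberg)
    also have "\<dots> \<subseteq> ?W - snd (initial ?G)"
      using complete by (auto simp: cdag_of_def initial_def)
    finally show ?thesis .
  qed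
  then have "real (card (updates n L)) = card (updates n L \<inter> (?W - snd (initial ?G)))"
    by (simp add: inf.absorb1)
  also have "\<dots> \<le> (loads ms / T + 1) * (T\<^sup>2 / ?w)"
  proof (rule card_computed_le)
    fix W W' P :: "loc node set"
    assume *: "down_closed ?G W" "down_closed ?G W'" "W \<subseteq> W'" "finite P" "card P \<le> S + T"
      "\<And>v. v \<in> W' - W \<Longrightarrow> preds ?G v \<subseteq> (W' - W) \<union> P"
    interpret segment n L W W' P
      using * assms(2) ST by unfold_locales auto
    have "4 * (?w * card (updates n L \<inter> E)) \<le> (card P + 3 * ?w)\<^sup>2"
      by (rule updates_bound)
    also have "\<dots> \<le> (2 * T)\<^sup>2"
      using *(5) T by (intro power_mono) auto
    finally have "?w * card (updates n L \<inter> E) \<le> T\<^sup>2"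
      by (simp add: power2_eq_square)
    then have "real ?w * card (updates n L \<inter> E) \<le> T\<^sup>2"
      by (metis of_nat_le_iff of_nat_mult)
    then show "card (updates n L \<inter> (W' - W)) \<le> T\<^sup>2 / ?w"
      by (simp add: E_def field_simps)
  next
    show "valid_config ?G S (initial ?G)"
      by (intro valid_config_initial edges_not_into_inputs)
  qed (use T legal finite_updates in auto)
  finally have "real ?w * card (updates n L) \<le> (loads ms / T + 1) * T\<^sup>2"
    by (simp add: field_simps)
  also have "\<dots> = real ((loads ms + T) * T)"
    using T by (simp add: field_simps power2_eq_square)
  finally show ?thesis
    by (metis of_nat_le_iff of_nat_mult)
qed

text \<open>Here \<open>u\<close> stands for \<open>(n - L + 1) * card (updates n L)\<close> with \<open>L = m = n div 2\<close>.\<close>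

lemma numeric_bound:
  fixes m n s t q u :: real
  assumes "7 \<le> m" "1 \<le> s" "12 * (n + 2 * s) \<le> n\<^sup>2 + 1"
    and parity: "n = 2 * m \<and> t = s + 3 * (m + 1) \<and> u = 3 * m^4 - 3 * m\<^sup>2 \<or>
      n = 2 * m + 1 \<and> t = s + 3 * (m + 2) \<and> u = 3 * m^4 + 13/2 * m^3 + m\<^sup>2 / 2 - m"
    and "u \<le> (q + t) * t"
  shows "1 / 12 * (n^4 / (n + 2 * s)) \<le> q"
proof -
  have m2: "7 * m \<le> m\<^sup>2" "49 \<le> m\<^sup>2"
    using assms(1) mult_mono[of 7 m 7 m] by (auto simp: power2_eq_square)
  have x: "0 < n + 2 * s" and t: "0 < t"
    using assms(1,2) parity by auto
  \<comment> \<open>The extreme case is \<open>m = 7\<close>, \<open>s = 1\<close> and odd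
    \<open>n\<close>, where this reads \<open>28 \<le> 28.05\<close>.\<close>
  have t_le: "t \<le> 33/20 * (n + 2 * s)"
    using assms(1,2) parity by auto
  have "t \<le> 3/5 * m\<^sup>2"
    using assms(3) m2 parity by (auto simp: power2_eq_square algebra_simps)
  then have "t\<^sup>2 \<le> (3/5 * m\<^sup>2)\<^sup>2"
    using t by (intro power_mono) auto
  then have t2: "t\<^sup>2 \<le> 9/25 * m^4"
    by (simp add: power_mult_distrib power2_eq_square power4_eq_xxxx)
  have "t / (n + 2 * s) \<le> 33/20"
    using t_le x by (simp add: field_simps)
  then have "n^4 * (t / (n + 2 * s)) \<le> n^4 * (33/20)"
    by (intro mult_left_mono) simp_all
  moreover have "(1 / 12 * (n^4 / (n + 2 * s)) + t) * t = 1 / 12 * (n^4 * (t / (n + 2 * s))) + t\<^sup>2"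
    by (simp add: power2_eq_square algebra_simps)
  ultimately have "(1 / 12 * (n^4 / (n + 2 * s)) + t) * t \<le> 11/80 * n^4 + 9/25 * m^4"
    using t2 by linarith
  \<comment> \<open>In terms of \<open>m\<close>, the leading coefficient on the left is
    \<open>11/80 * 16 + 9/25 = 2.56\<close>, below the \<open>3\<close> of \<open>u\<close>.\<close>
  also have "\<dots> \<le> u"
  proof -
    have m4: "49 * m\<^sup>2 \<le> m^4"
      using mult_right_mono[OF m2(2), of "m\<^sup>2"] by (simp add: power4_eq_xxxx power2_eq_square)
    have m3: "49 * m \<le> m^3"
      using mult_right_mono[OF m2(2), of m] assms(1) by (simp add: power3_eq_cube power2_eq_square)
    from parity show ?thesis
    proof
      assume *: "n = 2 * m \<and> t = s + 3 * (m + 1) \<and> u = 3 * m^4 - 3 * m\<^sup>2"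
      then have "n^4 = 16 * m^4"
        by (simp add: power_mult_distrib)
      then show ?thesis
        using * m4 m2 by linarith
    next
      assume *: "n = 2 * m + 1 \<and> t = s + 3 * (m + 2) \<and> u = 3 * m^4 + 13/2 * m^3 + m\<^sup>2 / 2 - m"
      then have "n^4 = 16 * m^4 + 32 * m^3 + 24 * m\<^sup>2 + 8 * m + 1"
        by (simp add: power4_eq_xxxx power3_eq_cube power2_eq_square algebra_simps)
      then show ?thesis
        using * m4 m3 m2 assms(1) by linarith
    qed
  qed
  finally have "(1 / 12 * (n^4 / (n + 2 * s)) + t) * t \<le> (q + t) * t"
    using assms(5) by linarith
  then show ?thesis
    using t by simp
qed

lemma loads_ge:
  assumes "3 \<le> N" "0 < S" "complete_game (graph N) S ms"
  shows "1 / 12 * (real N ^ 4 / (real N + 2 * real S)) \<le> loads ms"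
proof (cases "12 * (N + 2 * S) \<le> N\<^sup>2 + 1")
  \<comment> \<open>The inputs suffice here, by
    \<open>N^4 \<le> (N^2 - 1) * (N^2 + 2)\<close>.\<close>
  case False
  then have "N\<^sup>2 + 2 \<le> 12 * (N + 2 * S)"
    by simp
  then have x: "(real N)\<^sup>2 + 2 \<le> 12 * (real N + 2 * real S)"
    using of_nat_mono[of "N\<^sup>2 + 2", where ?'a = real] by fastforce
  have N2: "9 \<le> (real N)\<^sup>2"
    using assms(1) power_mono[of 3 "real N" 2] by simp
  have "real N ^ 4 \<le> ((real N)\<^sup>2 - 1) * ((real N)\<^sup>2 + 2)"
    using N2 by (simp add: power4_eq_xxxx power2_eq_square algebra_simps)
  also have "\<dots> \<le> ((real N)\<^sup>2 - 1) * (12 * (real N + 2 * real S))"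
    using N2 x by (intro mult_left_mono) auto
  finally have "1 / 12 * (real N ^ 4 / (real N + 2 * real S)) \<le> (real N)\<^sup>2 - 1"
    using assms(2) by (simp add: field_simps)
  also have "\<dots> = real (N\<^sup>2 - 1)"
    using assms(1) by (subst of_nat_diff) auto
  also have "\<dots> \<le> loads ms"
    using loads_ge_inputs[OF assms(1,3)] by linarith
  finally show ?thesis .
next
  case True
  \<comment> \<open>For \<open>N \<le> 13\<close> the case assumption would give
    \<open>24 * S \<le> N + 1\<close>, which fails for \<open>0 < S\<close>.\<close>
  have "14 \<le> N"
  proof (rule ccontr)
    assume "\<not> 14 \<le> N"
    then have "N\<^sup>2 + 1 \<le> 13 * N + 1"
      by (simp add: power2_eq_square)
    with True have "12 * (N + 2 * S) \<le> 13 * N + 1"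
      by (rule order_trans)
    then show False
      using assms(2) \<open>\<not> 14 \<le> N\<close> by presburger
  qed
  define m where "m = N div 2"
  define T where "T = S + 3 * (N - m + 1)"
  have m: "7 \<le> m" "m + 2 \<le> N"
    using \<open>14 \<le> N\<close> by (auto simp: m_def)
  have mm: "7 * m \<le> m * m"
    using m(1) by simp
  have "N = 2 * m \<or> N = 2 * m + 1"
    unfolding m_def by linarith
  then have parity: "N = 2 * m \<and> N - m + 1 = m + 1 \<and> N - m - 1 = m - 1 \<or>
      N = 2 * m + 1 \<and> N - m + 1 = m + 2 \<and> N - m - 1 = m"
    by presburger
  \<comment> \<open>The case assumption bounds \<open>2 * S\<close> by a third of
    \<open>m * m\<close>, while the right side is about \<open>m * m\<close>.\<close>
  then have ST: "S + T < (N - m - 1) * (N - m + 1)"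
  proof
    assume *: "N = 2 * m \<and> N - m + 1 = m + 1 \<and> N - m - 1 = m - 1"
    obtain d where "m = 7 + d"
      using m(1) le_Suc_ex[of 7 m] by auto
    then show ?thesis
      using * True by (simp add: T_def power2_eq_square algebra_simps)
  next
    assume *: "N = 2 * m + 1 \<and> N - m + 1 = m + 2 \<and> N - m - 1 = m"
    then show ?thesis
      using True mm m(1) by (simp add: T_def power2_eq_square algebra_simps)
  qed
  have "(N - m + 1) * card (updates N m) \<le> (loads ms + T) * T"
    by (rule loads_lower_bound[OF assms(3) m(2) T_def ST])
  moreover have "2 * card (updates N m) = N * m * (2 * N - 3 - m)"
    by (rule card_updates[OF m(2)])
  ultimately have "(N - m + 1) * (N * m * (2 * N - 3 - m)) \<le> 2 * ((loads ms + T) * T)"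
    by (metis mult.left_commute mult_le_mono2)
  then have "real ((N - m + 1) * (N * m * (2 * N - 3 - m))) \<le> real (2 * ((loads ms + T) * T))"
    by (rule of_nat_mono)
  moreover have "real (2 * N - 3 - m) = 2 * real N - 3 - real m" "real (N - m + 1) = real N - m + 1"
    using m by (simp_all add: of_nat_diff)
  ultimately have "(real N - m + 1) * (N * m * (2 * real N - 3 - m)) \<le> 2 * ((loads ms + real T) * T)"
    by (simp only: of_nat_mult of_nat_add[of "loads ms"] of_nat_numeral)
  then have "(real N - m + 1) * (N * m * (2 * real N - 3 - m)) / 2 \<le> (loads ms + real T) * T"
    by linarith
  moreover have "12 * (real N + 2 * real S) \<le> (real N)\<^sup>2 + 1"
    using of_nat_mono[OF True, where ?'a = real] by simp
  ultimately show ?thesis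
    using m(1) assms(2) parity
    by (intro numeric_bound[of m S N T "(real N - m + 1) * (N * m * (2 * real N - 3 - m)) / 2"])
      (auto simp: T_def power4_eq_xxxx power3_eq_cube power2_eq_square field_simps)
qed

theorem theorem7:
  fixes N S :: nat
  assumes "3 \<le> N" and "0 < S"
  shows "ereal (1 / 12 * (real N ^ 4 / (real N + 2 * real S))) \<le> ereal_of_enat (hessenberg_Q N S)"
proof -
  define c where "c = 1 / 12 * (real N ^ 4 / (real N + 2 * real S))"
  \<comment> \<open>Loads are counted by integers, so the bound can be rounded up and compared with
    the infimum in \<open>enat\<close>.\<close>
  have "enat (nat \<lceil>c\<rceil>) \<le> hessenberg_Q N S"
    unfolding hessenberg_Q_def io_complexity_def
  proof (rule INF_greatest)
    fix ms assume "ms \<in> {ms. complete_game (graph N) S ms}"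
    then have "c \<le> loads ms"
      using loads_ge[OF assms] by (simp add: c_def)
    then show "enat (nat \<lceil>c\<rceil>) \<le> enat (loads ms)"
      by (simp add: ceiling_le_iff)
  qed
  then have "ereal_of_enat (enat (nat \<lceil>c\<rceil>)) \<le> ereal_of_enat (hessenberg_Q N S)"
    by (simp only: ereal_of_enat_le_iff)
  moreover have "c \<le> real (nat \<lceil>c\<rceil>)"
    by (rule real_nat_ceiling_ge)
  ultimately show ?thesis
    unfolding c_def[symmetric] by (simp add: order_trans[rotated])
qed

end
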